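(* Consider the weighted query-commit model for bipartite matching (defined in the context) on an instance $G=(A,B,E)$ with weights $w$ and existence probabilities $p_e$ satisfying $0<p_e<1$ for all $e\in E$. Then the expected utility of the algorithm Approx-QC (defined in the context) is at least $(1-1/e)\cdot\mathrm{OPT}$, where $\mathrm{OPT}$ is the maximum expected utility achievable by any query-commit algorithm.
   Context: Weighted query-commit model: $G=(A,B,E)$ is a bipartite graph with $|A|=|B|=n$; each edge $e$ has a weight $w(e)\ge 0$ and exists independently with probability $p_e$. An algorithm adaptively queries edges; a query reveals whether the edge exists, and if it exists the algorithm must add it to its output. The algorithm may only query edges that do not share an endpoint with an edge already in its output, so the output $M$ (the set of queried edges that exist) is a matching. The utility of an algorithm is $\mathbb{E}[\sum_{e\in M}w(e)]$ (over the edge randomness and the algorithm's internal randomness); $\mathrm{OPT}$ is the maximum utility over all query-commit algorithms. For a vertex $u$, $\delta(u)$ is the set of edges incident to $u$; for $F\subseteq E$, $f(F)=1-\prod_{e\in F}(1-p_e)$ (the probability that some edge in $F$ exists). $\mathrm{LP}_{QC}$ is the linear program: maximize $\sum_{e\in E}x_e w(e)$ subject to $\sum_{e\in F}x_e\le f(F)$ for all $u\in A\cup B$ and all $F\subseteq\delta(u)$, and $x_e\ge 0$ for all $e$. Let $x^\ast$ be an optimal solution of $\mathrm{LP}_{QC}$. For each $a\in A$, $\mathcal{D}_a$ is a probability distribution over orderings $\sigma$ of subsets of $\delta(a)$ with the property that the procedure "draw $\sigma\sim\mathcal{D}_a$, query the edges in the order of $\sigma$, and output the first edge that exists (outputting nothing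 if none exists)" outputs each edge $e\in\delta(a)$ with probability exactly $x^\ast_e$. Algorithm Approx-QC: compute $x^\ast$ and $\mathcal{D}_a$ for all $a\in A$; for each $a\in A$ draw an arrival time $t_a\in[0,1]$ independently and uniformly at random; for each $b\in B$ set $c_b=\sum_{e\in\delta(b)}x^\ast_e w(e)$; start with $M=\emptyset$. For each $a\in A$ in increasing order of $t_a$: draw $\sigma\sim\mathcal{D}_a$ and, for each edge $e=(a,b)$ in the order of $\sigma$: if $w(e)\ge(1-e^{t_a-1})c_b$ and $b$ is not matched in $M$, query $e$, and if it exists add it to $M$ and move on to the next vertex of $A$; otherwise flip an independent coin with heads probability $p_e$, and if heads move on to the next vertex of $A$. Return $M$. *)

theory Defs
  imports "HOL-Probability.Probability" "HOL-Probability.Product_PMF"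
begin

text \<open>
  The two sides of the bipartite graph live in the types \<open>'a\<close> and \<open>'b\<close>, so they are disjoint and
  an edge is a pair. For a set \<open>E\<close> of edges, \<open>delta_A E a\<close> and \<open>delta_B E b\<close> are the edges incident
  to a vertex.
\<close>

type_synonym ('a, 'b) edge = "'a \<times> 'b"

definition delta_A :: "('a, 'b) edge set \<Rightarrow> 'a \<Rightarrow> ('a, 'b) edge set" where
  "delta_A E a = {e \<in> E. fst e = a}"

definition delta_B :: "('a, 'b) edge set \<Rightarrow> 'b \<Rightarrow> ('a, 'b) edge set" where
  "delta_B E b = {e \<in> E. snd e = b}"

definition share_endpoint :: "('a, 'b) edge \<Rightarrow> ('a, 'b) edge \<Rightarrow> bool" where
  "share_endpoint e e' \<longleftrightarrow> fst e = fst e' \<or> snd e = snd e'"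

definition existing_edges ::
    "('a, 'b) edge set \<Rightarrow> (('a, 'b) edge \<Rightarrow> real) \<Rightarrow> (('a, 'b) edge \<Rightarrow> bool) pmf" where
  "existing_edges E p = Pi_pmf E False (\<lambda>e. bernoulli_pmf (p e))"

text \<open>
  Adaptive querying strategies as decision trees. \<open>Query e k\<close> queries \<open>e\<close> and continues with
  \<open>k True\<close> if \<open>e\<close> exists and with \<open>k False\<close> otherwise; \<open>Flip D\<close> continues with a strategy drawn from
  \<open>D\<close> with fresh internal randomness. Whether edges exist is fixed in advance by \<open>X\<close>, and \<open>run X P M\<close>
  is the law of the output when \<open>P\<close> is started with output \<open>M\<close>. A strategy does not control its
  output: exactly the queried edges that exist are added.
\<close>

datatype 'e strategy = Stop | Flip "'e strategy pmf" | Query 'e "bool \<Rightarrow> 'e strategy"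

primrec run :: "('e \<Rightarrow> bool) \<Rightarrow> 'e strategy \<Rightarrow> 'e set \<Rightarrow> 'e set pmf" where
  "run X Stop = (\<lambda>M. return_pmf M)"
| "run X (Flip D) = (\<lambda>M. bind_pmf (map_pmf (run X) D) (\<lambda>r. r M))"
| "run X (Query e k) = (\<lambda>M. run X (k (X e)) (if X e then insert e M else M))"

text \<open>\<open>admissible E M P\<close>: started with output \<open>M\<close>, the strategy \<open>P\<close> only makes permitted queries.\<close>

inductive admissible ::
    "('a, 'b) edge set \<Rightarrow> ('a, 'b) edge set \<Rightarrow> ('a, 'b) edge strategy \<Rightarrow> bool"
  for E where
  Stop: "admissible E M Stop"
| Flip: "(\<And>P. P \<in> set_pmf D \<Longrightarrow> admissible E M P) \<Longrightarrow> admissible E M (Flip D)"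
| Query: "e \<in> E \<Longrightarrow> (\<And>e'. e' \<in> M \<Longrightarrow> \<not> share_endpoint e e') \<Longrightarrow>
    admissible E (insert e M) (k True) \<Longrightarrow> admissible E M (k False) \<Longrightarrow>
    admissible E M (Query e k)"

definition output_law ::
    "('a, 'b) edge set \<Rightarrow> (('a, 'b) edge \<Rightarrow> real) \<Rightarrow> ('a, 'b) edge strategy \<Rightarrow> ('a, 'b) edge set pmf" where
  "output_law E p P = bind_pmf (existing_edges E p) (\<lambda>X. run X P {})"

text \<open>
  Since \<open>Flip\<close> only provides discrete randomness, an algorithm may in addition use a random seed,
  independent of the edges and drawn from an arbitrary probability space \<open>R\<close>: it is a measurable
  family \<open>P\<close> of admissible strategies indexed by the seed.
\<close>

definition query_commit_algorithm ::
    "('a, 'b) edge set \<Rightarrow> 'r measure \<Rightarrow> ('r \<Rightarrow> ('a, 'b) edge strategy) \<Rightarrow> bool" where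
  "query_commit_algorithm E R P \<longleftrightarrow>
     prob_space R \<and>
     (\<forall>s \<in> space R. admissible E {} (P s)) \<and>
     (\<forall>X M. (\<lambda>s. pmf (run X (P s) {}) M) \<in> borel_measurable R)"

definition utility ::
    "('a, 'b) edge set \<Rightarrow> (('a, 'b) edge \<Rightarrow> real) \<Rightarrow> (('a, 'b) edge \<Rightarrow> real) \<Rightarrow>
     'r measure \<Rightarrow> ('r \<Rightarrow> ('a, 'b) edge strategy) \<Rightarrow> real" where
  "utility E p w R P =
     (\<integral>s. measure_pmf.expectation (output_law E p (P s)) (\<lambda>M. \<Sum>e\<in>M. w e) \<partial>R)"

text \<open>
  The seed type \<open>'a \<Rightarrow> real\<close> is rich enough for every source of randomness that is relevant here,
  in particular for the arrival times used by \<open>approx_QC\<close> below.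
\<close>

definition OPT ::
    "('a, 'b) edge set \<Rightarrow> (('a, 'b) edge \<Rightarrow> real) \<Rightarrow> (('a, 'b) edge \<Rightarrow> real) \<Rightarrow> real" where
  "OPT E p w = Sup {utility E p w R P | (R :: ('a \<Rightarrow> real) measure) P. query_commit_algorithm E R P}"

definition prob_some_exists :: "('e \<Rightarrow> real) \<Rightarrow> 'e set \<Rightarrow> real" where
  "prob_some_exists p F = 1 - (\<Prod>e\<in>F. 1 - p e)"

definition LP_QC_feasible ::
    "'a set \<Rightarrow> 'b set \<Rightarrow> ('a, 'b) edge set \<Rightarrow> (('a, 'b) edge \<Rightarrow> real) \<Rightarrow>
     (('a, 'b) edge \<Rightarrow> real) \<Rightarrow> bool" where
  "LP_QC_feasible A B E p x \<longleftrightarrow>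
     (\<forall>a\<in>A. \<forall>F. F \<subseteq> delta_A E a \<longrightarrow> (\<Sum>e\<in>F. x e) \<le> prob_some_exists p F) \<and>
     (\<forall>b\<in>B. \<forall>F. F \<subseteq> delta_B E b \<longrightarrow> (\<Sum>e\<in>F. x e) \<le> prob_some_exists p F) \<and>
     (\<forall>e\<in>E. 0 \<le> x e)"

definition LP_QC_optimal ::
    "'a set \<Rightarrow> 'b set \<Rightarrow> ('a, 'b) edge set \<Rightarrow> (('a, 'b) edge \<Rightarrow> real) \<Rightarrow>
     (('a, 'b) edge \<Rightarrow> real) \<Rightarrow> (('a, 'b) edge \<Rightarrow> real) \<Rightarrow> bool" where
  "LP_QC_optimal A B E p w x \<longleftrightarrow>
     LP_QC_feasible A B E p x \<and>
     (\<forall>y. LP_QC_feasible A B E p y \<longrightarrow> (\<Sum>e\<in>E. y e * w e) \<le> (\<Sum>e\<in>E. x e * w e))"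

text \<open>
  \<open>Da\<close> is a distribution over orderings of subsets of \<open>delta_A E a\<close> such that querying the edges
  in the drawn order until one exists outputs each \<open>e\<close> with probability \<open>x e\<close>.
\<close>

definition query_order_distribution ::
    "('a, 'b) edge set \<Rightarrow> (('a, 'b) edge \<Rightarrow> real) \<Rightarrow> (('a, 'b) edge \<Rightarrow> real) \<Rightarrow> 'a \<Rightarrow>
     ('a, 'b) edge list pmf \<Rightarrow> bool" where
  "query_order_distribution E p x a Da \<longleftrightarrow>
     (\<forall>\<sigma> \<in> set_pmf Da. distinct \<sigma> \<and> set \<sigma> \<subseteq> delta_A E a) \<and>
     (\<forall>e \<in> delta_A E a.
        pmf (bind_pmf Da (\<lambda>\<sigma>. map_pmf (\<lambda>X. find X \<sigma>) (existing_edges E p))) (Some e) = x e)"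

text \<open>
  Inner loop for a vertex of \<open>A\<close> that arrives at time \<open>ta\<close>: \<open>c\<close> are the thresholds, \<open>M\<close> is the
  current matching and \<open>k\<close> is the strategy for the remaining vertices, given the new matching.
\<close>

fun approx_QC_inner ::
    "(('a, 'b) edge \<Rightarrow> real) \<Rightarrow> (('a, 'b) edge \<Rightarrow> real) \<Rightarrow> ('b \<Rightarrow> real) \<Rightarrow> real \<Rightarrow>
     ('a, 'b) edge set \<Rightarrow> (('a, 'b) edge set \<Rightarrow> ('a, 'b) edge strategy) \<Rightarrow>
     ('a, 'b) edge list \<Rightarrow> ('a, 'b) edge strategy" where
  "approx_QC_inner p w c ta M k [] = k M"
| "approx_QC_inner p w c ta M k (e # \<sigma>) =
     (if w e \<ge> (1 - exp (ta - 1)) * c (snd e) \<and> snd e \<notin> snd ` M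
      then Query e (\<lambda>ex. if ex then k (insert e M) else approx_QC_inner p w c ta M k \<sigma>)
      else Flip (map_pmf (\<lambda>heads. if heads then k M else approx_QC_inner p w c ta M k \<sigma>)
             (bernoulli_pmf (p e))))"

fun approx_QC_outer ::
    "(('a, 'b) edge \<Rightarrow> real) \<Rightarrow> (('a, 'b) edge \<Rightarrow> real) \<Rightarrow> ('b \<Rightarrow> real) \<Rightarrow>
     ('a \<Rightarrow> ('a, 'b) edge list pmf) \<Rightarrow> ('a \<Rightarrow> real) \<Rightarrow> 'a list \<Rightarrow>
     ('a, 'b) edge set \<Rightarrow> ('a, 'b) edge strategy" where
  "approx_QC_outer p w c D t [] M = Stop"
| "approx_QC_outer p w c D t (a # as) M =
     Flip (map_pmf (approx_QC_inner p w c (t a) M (approx_QC_outer p w c D t as)) (D a))"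

text \<open>
  The vertices of \<open>A\<close> in increasing order of \<open>t\<close>; ties, which have probability zero, are broken
  according to some fixed enumeration of \<open>A\<close>.
\<close>

definition arrival_order :: "'a set \<Rightarrow> ('a \<Rightarrow> real) \<Rightarrow> 'a list" where
  "arrival_order A t = sort_key t (SOME as. distinct as \<and> set as = A)"

definition approx_QC ::
    "'a set \<Rightarrow> ('a, 'b) edge set \<Rightarrow> (('a, 'b) edge \<Rightarrow> real) \<Rightarrow> (('a, 'b) edge \<Rightarrow> real) \<Rightarrow>
     (('a, 'b) edge \<Rightarrow> real) \<Rightarrow> ('a \<Rightarrow> ('a, 'b) edge list pmf) \<Rightarrow>
     ('a \<Rightarrow> real) \<Rightarrow> ('a, 'b) edge strategy" where
  "approx_QC A E p w x D t =
     approx_QC_outer p w (\<lambda>b. \<Sum>e\<in>delta_B E b. x e * w e) D t (arrival_order A t) {}"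

definition arrival_times :: "'a set \<Rightarrow> ('a \<Rightarrow> real) measure" where
  "arrival_times A = PiM A (\<lambda>_. uniform_measure lborel {0..1})"

end

theory Submission
  imports Defs
begin

text \<open>
  The probabilities with which a query-commit algorithm outputs the edges are feasible for
  \<open>LP_QC\<close>: the edges output at a vertex exist, and there is at most one of them. Hence \<open>OPT\<close> is at
  most the value of the linear program.

  Conversely, no edge is queried twice, so each query may be answered by a fresh coin. Then each
  \<open>a\<close> independently proposes one candidate edge, equal to \<open>e\<close> with probability \<open>x e\<close>, and every \<open>b\<close>
  sees a prophet secretary instance of its own: it takes the first candidate that beats the threshold
  \<open>(1 - exp (t - 1)) * c b\<close> at its arrival time \<open>t\<close>. Conditioning on the arrival time of the taken
  candidate turns the expected gain of \<open>b\<close> into a one-dimensional integral, which is at least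
  \<open>(1 - 1 / exp 1) * c b\<close>, and the numbers \<open>c b\<close> sum to the value of the linear program.
\<close>

section \<open>The linear program bounds OPT\<close>

lemma share_endpoint_commute: "share_endpoint e e' = share_endpoint e' e"
  by (auto simp: share_endpoint_def)

lemma run_output:
  assumes "admissible E M P" "N \<in> set_pmf (run X P M)"
  shows "M \<subseteq> N" "N \<subseteq> M \<union> {e \<in> E. X e}"
    "pairwise (\<lambda>e e'. \<not> share_endpoint e e') M \<Longrightarrow>
     pairwise (\<lambda>e e'. \<not> share_endpoint e e') N"
proof -
  have "M \<subseteq> N \<and> N \<subseteq> M \<union> {e \<in> E. X e} \<and>
    (pairwise (\<lambda>e e'. \<not> share_endpoint e e') M \<longrightarrow>
     pairwise (\<lambda>e e'. \<not> share_endpoint e e') N)"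
    using assms
  proof (induction M P)
    case (Stop M)
    then show ?case by simp
  next
    case (Flip D M)
    then show ?case by auto
  next
    case (Query e M k)
    show ?case
    proof (cases "X e")
      case True
      with Query.prems Query.IH(1) have "insert e M \<subseteq> N"
        "N \<subseteq> insert e M \<union> {e \<in> E. X e}"
        "pairwise (\<lambda>e e'. \<not> share_endpoint e e') (insert e M) \<longrightarrow>
         pairwise (\<lambda>e e'. \<not> share_endpoint e e') N"
        by auto
      moreover have "\<not> share_endpoint e' e" if "e' \<in> M" for e'
        using Query.hyps(2)[OF that] by (subst share_endpoint_commute)
      with Query.hyps(2) have "pairwise (\<lambda>e e'. \<not> share_endpoint e e') M \<Longrightarrow>
         pairwise (\<lambda>e e'. \<not> share_endpoint e e') (insert e M)"
        by (simp add: pairwise_insert)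
      ultimately show ?thesis using True Query.hyps(1) by auto
    next
      case False
      with Query show ?thesis by auto
    qed
  qed
  then show "M \<subseteq> N" "N \<subseteq> M \<union> {e \<in> E. X e}"
    "pairwise (\<lambda>e e'. \<not> share_endpoint e e') M \<Longrightarrow>
     pairwise (\<lambda>e e'. \<not> share_endpoint e e') N" by blast+
qed

text \<open>The complement is the box on which every coordinate in \<open>F\<close> is
  \<open>False\<close>, and the probability of a box factorises under the product law.\<close>

lemma prob_existing_edges_some:
  assumes "finite E" "F \<subseteq> E" "\<And>e. e \<in> E \<Longrightarrow> 0 \<le> p e \<and> p e \<le> 1"
  shows "measure_pmf.prob (existing_edges E p) {X. \<exists>e\<in>F. X e} = prob_some_exists p F"
proof -
  let ?B = "\<lambda>e. if e \<in> F then {False} else UNIV"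
  have "{X. \<exists>e\<in>F. X e} = UNIV - Pi E ?B"
    using assms(2) by (auto simp: Pi_def)
  then have "measure_pmf.prob (existing_edges E p) {X. \<exists>e\<in>F. X e} =
      1 - measure_pmf.prob (existing_edges E p) (Pi E ?B)"
    using measure_pmf.prob_compl[of "Pi E ?B" "existing_edges E p"] by simp
  also have "measure_pmf.prob (existing_edges E p) (Pi E ?B) =
      (\<Prod>e\<in>E. measure_pmf.prob (bernoulli_pmf (p e)) (?B e))"
    unfolding existing_edges_def using assms(1) by (rule measure_Pi_pmf_Pi)
  also have "\<dots> = (\<Prod>e\<in>E. if e \<in> F then 1 - p e else 1)"
    using assms(3) by (intro prod.cong) (auto simp: measure_pmf_single)
  also have "\<dots> = (\<Prod>e\<in>F. 1 - p e)"
    using assms(1,2) by (simp add: prod.If_cases Int_absorb1)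
  finally show ?thesis by (simp add: prob_some_exists_def)
qed

text \<open>Two distinct output edges never share an endpoint, so at most one edge of
  \<open>F\<close> is output, and if one is, then some edge of \<open>F\<close> exists. Taking
  expectations of this pointwise inequality gives the bound.\<close>

lemma sum_output_prob_le:
  assumes "finite E" "F \<subseteq> E" "\<And>e. e \<in> E \<Longrightarrow> 0 \<le> p e \<and> p e \<le> 1"
    and adm: "admissible E {} P"
    and star: "\<And>e e'. e \<in> F \<Longrightarrow> e' \<in> F \<Longrightarrow> share_endpoint e e'"
  shows "(\<Sum>e\<in>F. measure_pmf.prob (output_law E p P) {M. e \<in> M}) \<le> prob_some_exists p F"
proof -
  \<comment> \<open>\<open>J\<close> is the joint law of the existing edges and the output; on it
    the two indicators can be compared pointwise.\<close>
  define J where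
    "J = bind_pmf (existing_edges E p) (\<lambda>X. map_pmf (Pair X) (run X P {}))"
  have out: "output_law E p P = map_pmf snd J"
    by (simp add: J_def output_law_def map_bind_pmf pmf.map_comp o_def)
  have ex: "existing_edges E p = map_pmf fst J"
    by (simp add: J_def map_bind_pmf pmf.map_comp o_def bind_return_pmf')
  have fin: "finite F" using assms(1,2) by (rule rev_finite_subset)
  have J: "(\<Sum>e\<in>F. indicator {M. e \<in> M} (snd z)) \<le> (indicator {X. \<exists>e\<in>F. X e} (fst z) :: real)"
    if "z \<in> set_pmf J" for z
  proof -
    obtain X M where "z = (X, M)" by (cases z)
    with that have z: "z = (X, M)" "M \<in> set_pmf (run X P {})"
      by (auto simp: J_def)
    have sub: "M \<subseteq> {e \<in> E. X e}" and pw: "pairwise (\<lambda>e e'. \<not> share_endpoint e e') M"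
      using run_output[OF adm z(2)] by auto
    have eq: "(\<Sum>e\<in>F. indicator {M. e \<in> M} M) = real (card (F \<inter> M))"
      using fin by (simp add: indicator_def sum.If_cases Int_def)
    show ?thesis
    proof (cases "F \<inter> M = {}")
      case True
      then show ?thesis using eq by (simp add: z)
    next
      case False
      then obtain e where e: "e \<in> F" "e \<in> M" by auto
      have "F \<inter> M = {e}"
        using pw e star unfolding pairwise_def by blast
      moreover have "X e" using sub e by auto
      ultimately show ?thesis using eq e by (auto simp: z indicator_def)
    qed
  qed
  have "(\<Sum>e\<in>F. measure_pmf.prob (output_law E p P) {M. e \<in> M}) =
      (\<Sum>e\<in>F. measure_pmf.expectation J (\<lambda>z. indicator {M. e \<in> M} (snd z)))"
    by (intro sum.cong refl, subst out)
       (simp flip: measure_pmf.emeasure_eq_measure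
          integral_map_pmf[where f = "indicator _" and g = snd])
  also have "\<dots> = measure_pmf.expectation J (\<lambda>z. \<Sum>e\<in>F. indicator {M. e \<in> M} (snd z))"
    by (rule Bochner_Integration.integral_sum[symmetric])
       (auto intro!: measure_pmf.integrable_const_bound[where B = 1] AE_pmfI)
  also have "\<dots> \<le> measure_pmf.expectation J (\<lambda>z. indicator {X. \<exists>e\<in>F. X e} (fst z))"
    by (rule integral_mono_AE)
       (auto intro!: Bochner_Integration.integrable_sum measure_pmf.integrable_const_bound[where B = 1] AE_pmfI J)
  also have "\<dots> = measure_pmf.prob (existing_edges E p) {X. \<exists>e\<in>F. X e}"
    by (subst ex) (simp flip: integral_map_pmf[where f = "indicator _" and g = fst])
  finally show ?thesis
    using prob_existing_edges_some[OF assms(1,2,3)] by simp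
qed

text \<open>The output probabilities \<open>y\<close> satisfy every constraint, because the edges at
  one vertex pairwise share it as an endpoint. By linearity of expectation the expected weight is
  the objective value of \<open>y\<close>.\<close>

lemma expected_weight_le_LP:
  assumes "finite E" "\<And>e. e \<in> E \<Longrightarrow> 0 \<le> p e \<and> p e \<le> 1"
    and adm: "admissible E {} P" and opt: "LP_QC_optimal A B E p w x"
  shows "measure_pmf.expectation (output_law E p P) (\<lambda>M. \<Sum>e\<in>M. w e) \<le> (\<Sum>e\<in>E. x e * w e)"
proof -
  define y where "y e = measure_pmf.prob (output_law E p P) {M. e \<in> M}" for e
  have "LP_QC_feasible A B E p y"
    unfolding LP_QC_feasible_def y_def
  proof (intro conjI ballI allI impI)
    fix a F assume "F \<subseteq> delta_A E a"
    then have "F \<subseteq> E" "fst e = a" if "e \<in> F" for e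
      using that by (auto simp: delta_A_def)
    then show "(\<Sum>e\<in>F. measure_pmf.prob (output_law E p P) {M. e \<in> M}) \<le> prob_some_exists p F"
      by (intro sum_output_prob_le[OF assms(1) _ assms(2) adm]) (auto simp: share_endpoint_def)
  next
    fix b F assume "F \<subseteq> delta_B E b"
    then have "F \<subseteq> E" "snd e = b" if "e \<in> F" for e
      using that by (auto simp: delta_B_def)
    then show "(\<Sum>e\<in>F. measure_pmf.prob (output_law E p P) {M. e \<in> M}) \<le> prob_some_exists p F"
      by (intro sum_output_prob_le[OF assms(1) _ assms(2) adm]) (auto simp: share_endpoint_def)
  qed simp
  then have le: "(\<Sum>e\<in>E. y e * w e) \<le> (\<Sum>e\<in>E. x e * w e)"
    using opt by (simp add: LP_QC_optimal_def)
  have sub: "M \<subseteq> E" if "M \<in> set_pmf (output_law E p P)" for M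
    using that run_output(2)[OF adm] by (fastforce simp: output_law_def)
  have "measure_pmf.expectation (output_law E p P) (\<lambda>M. \<Sum>e\<in>M. w e) =
      measure_pmf.expectation (output_law E p P) (\<lambda>M. \<Sum>e\<in>E. indicator {M. e \<in> M} M * w e)"
  proof (rule integral_cong_AE; (simp add: AE_measure_pmf_iff)?; intro ballI)
    fix M assume "M \<in> set_pmf (output_law E p P)"
    then have "E \<inter> M = M" using sub by auto
    then have "(\<Sum>e\<in>M. w e) = (\<Sum>e\<in>E. if e \<in> M then w e else 0)"
      using sum.inter_restrict[OF assms(1), of w M] by simp
    also have "\<dots> = (\<Sum>e\<in>E. indicator {M. e \<in> M} M * w e)"
      by (intro sum.cong) auto
    finally show "(\<Sum>e\<in>M. w e) = (\<Sum>e\<in>E. indicator {M. e \<in> M} M * w e)" .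
  qed
  also have "\<dots> = (\<Sum>e\<in>E. y e * w e)"
    by (subst Bochner_Integration.integral_sum)
       (auto simp: y_def intro!: integrable_mult_left measure_pmf.integrable_const_bound[where B = 1])
  finally show ?thesis using le by simp
qed

lemma OPT_le_LP:
  assumes "finite E" "\<And>e. e \<in> E \<Longrightarrow> 0 \<le> p e \<and> p e \<le> 1" "\<And>e. e \<in> E \<Longrightarrow> 0 \<le> w e"
    and opt: "LP_QC_optimal A B E p w x"
  shows "OPT E p w \<le> (\<Sum>e\<in>E. x e * w e)"
  unfolding OPT_def
proof (rule cSup_least)
  \<comment> \<open>A supremum of reals inherits an upper bound only from a nonempty set; stopping
    at once with a deterministic seed is a witness.\<close>
  let ?R = "return (count_space UNIV) (undefined :: 'a \<Rightarrow> real)"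
  have "query_commit_algorithm E ?R (\<lambda>_. Stop)"
    unfolding query_commit_algorithm_def
    by (auto intro!: prob_space_return admissible.Stop)
  then show "{utility E p w R P | (R :: ('a \<Rightarrow> real) measure) P. query_commit_algorithm E R P} \<noteq> {}"
    by blast
next
  fix u assume "u \<in> {utility E p w R P | (R :: ('a \<Rightarrow> real) measure) P. query_commit_algorithm E R P}"
  then obtain R :: "('a \<Rightarrow> real) measure" and P
    where u: "u = utility E p w R P" and q: "query_commit_algorithm E R P" by blast
  interpret prob_space R using q by (simp add: query_commit_algorithm_def)
  let ?f = "\<lambda>s. measure_pmf.expectation (output_law E p (P s)) (\<lambda>M. \<Sum>e\<in>M. w e)"
  show "u \<le> (\<Sum>e\<in>E. x e * w e)"
  proof (cases "integrable R ?f")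
    case True
    then show ?thesis unfolding u utility_def
      using q assms(1,2) opt
      by (intro integral_le_const AE_I2 expected_weight_le_LP) (auto simp: query_commit_algorithm_def)
  next
    case False
    \<comment> \<open>A non-integrable function has integral \<open>0\<close> by convention, so
      nonnegativity of the bound suffices here.\<close>
    have "0 \<le> (\<Sum>e\<in>E. x e * w e)"
      using opt assms(3) by (intro sum_nonneg) (auto simp: LP_QC_optimal_def LP_QC_feasible_def)
    then show ?thesis using False by (simp add: u utility_def not_integrable_integral_eq)
  qed
qed

section \<open>Reduction to independent candidates\<close>

text \<open>The principle of deferred decisions: instead of consulting edges sampled in advance,
  each query tosses its coin when it is made.\<close>

primrec run_fresh :: "('e \<Rightarrow> real) \<Rightarrow> 'e strategy \<Rightarrow> 'e set \<Rightarrow> 'e set pmf" where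
  "run_fresh p Stop = (\<lambda>M. return_pmf M)"
| "run_fresh p (Flip D) = (\<lambda>M. bind_pmf (map_pmf (run_fresh p) D) (\<lambda>r. r M))"
| "run_fresh p (Query e k) = (\<lambda>M. bind_pmf (bernoulli_pmf (p e))
     (\<lambda>b. run_fresh p (k b) (if b then insert e M else M)))"

text \<open>\<open>S\<close> is the budget of edges that may still be queried. A query spends its
  edge in both branches, so no execution path asks about the same edge twice.\<close>

inductive non_repeating :: "'e set \<Rightarrow> 'e strategy \<Rightarrow> bool" where
  Stop: "non_repeating S Stop"
| Flip: "(\<And>P. P \<in> set_pmf D \<Longrightarrow> non_repeating S P) \<Longrightarrow> non_repeating S (Flip D)"
| Query: "e \<in> S \<Longrightarrow> (\<And>b. non_repeating (S - {e}) (k b)) \<Longrightarrow> non_repeating S (Query e k)"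

lemma non_repeating_mono: "non_repeating S P \<Longrightarrow> S \<subseteq> T \<Longrightarrow> non_repeating T P"
proof (induction S P arbitrary: T rule: non_repeating.induct)
  case (Query e S k)
  then have "non_repeating (T - {e}) (k b)" for b by (meson Diff_mono order_refl)
  with Query show ?case by (auto intro: non_repeating.Query)
qed (auto intro: non_repeating.intros)

lemma run_cong:
  "non_repeating S P \<Longrightarrow> (\<And>e. e \<in> S \<Longrightarrow> X e = Y e) \<Longrightarrow> run X P M = run Y P M"
proof (induction S P arbitrary: M rule: non_repeating.induct)
  case (Flip D S)
  then have "bind_pmf D (\<lambda>P. run X P M) = bind_pmf D (\<lambda>P. run Y P M)"
    by (intro bind_pmf_cong) auto
  then show ?case by (simp add: bind_map_pmf)
qed auto

text \<open>At a query of \<open>e\<close> the coordinate \<open>e\<close> is split off the product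
  law. The continuation never looks at it again, so by \<open>run_cong\<close> the other coordinates
  serve as independent randomness for the rest of the run.\<close>

lemma bind_existing_edges_run:
  assumes "non_repeating S P" "finite S"
  shows "bind_pmf (existing_edges S p) (\<lambda>X. run X P M) = run_fresh p P M"
  using assms
proof (induction S P arbitrary: M rule: non_repeating.induct)
  case (Stop S)
  then show ?case by simp
next
  case (Flip D S)
  have "bind_pmf (existing_edges S p) (\<lambda>X. run X (Flip D) M) =
      bind_pmf D (\<lambda>P. bind_pmf (existing_edges S p) (\<lambda>X. run X P M))"
    by (simp add: bind_map_pmf) (rule bind_commute_pmf)
  also have "\<dots> = bind_pmf D (\<lambda>P. run_fresh p P M)"
    using Flip by (intro bind_pmf_cong) auto
  finally show ?case by (simp add: bind_map_pmf)
next
  case (Query e S k)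
  let ?r = "\<lambda>b X. run X (k b) (if b then insert e M else M)"
  have S: "existing_edges S p = bind_pmf (bernoulli_pmf (p e))
      (\<lambda>b. bind_pmf (existing_edges (S - {e}) p) (\<lambda>X. return_pmf (X(e := b))))"
    using Query.prems Query.hyps(1) Pi_pmf_insert'[of "S - {e}" e False "\<lambda>e. bernoulli_pmf (p e)"]
    by (simp add: existing_edges_def insert_absorb)
  have "bind_pmf (existing_edges S p) (\<lambda>X. run X (Query e k) M) =
      bind_pmf (bernoulli_pmf (p e)) (\<lambda>b. bind_pmf (existing_edges (S - {e}) p)
        (\<lambda>X. ?r b (X(e := b))))"
    by (subst S) (simp add: bind_assoc_pmf bind_return_pmf)
  also have "\<dots> = bind_pmf (bernoulli_pmf (p e)) (\<lambda>b. bind_pmf (existing_edges (S - {e}) p) (?r b))"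
    using Query.hyps(2) by (intro bind_pmf_cong refl run_cong[where S = "S - {e}"]) auto
  also have "\<dots> = run_fresh p (Query e k) M"
    using Query by simp
  finally show ?case .
qed

section \<open>The candidate proposed by an arriving vertex\<close>

primrec first_success :: "('e \<Rightarrow> real) \<Rightarrow> 'e list \<Rightarrow> 'e option pmf" where
  "first_success p [] = return_pmf None"
| "first_success p (e # \<sigma>) = bind_pmf (bernoulli_pmf (p e))
     (\<lambda>b. if b then return_pmf (Some e) else first_success p \<sigma>)"

text \<open>Deferred decisions again, now for a fixed query order: as the order is distinct, the
  coin of its head does not affect the search in the tail.\<close>

lemma map_find_existing_edges:
  assumes "distinct \<sigma>" "set \<sigma> \<subseteq> S" "finite S"
  shows "map_pmf (\<lambda>X. find X \<sigma>) (existing_edges S p) = first_success p \<sigma>"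
  using assms
proof (induction \<sigma> arbitrary: S)
  case Nil
  then show ?case by simp
next
  case (Cons e \<sigma>)
  have S: "existing_edges S p = bind_pmf (bernoulli_pmf (p e))
      (\<lambda>b. bind_pmf (existing_edges (S - {e}) p) (\<lambda>X. return_pmf (X(e := b))))"
    using Cons.prems Pi_pmf_insert'[of "S - {e}" e False "\<lambda>e. bernoulli_pmf (p e)"]
    by (simp add: existing_edges_def insert_absorb)
  have upd: "find (X(e := b)) \<sigma> = find X \<sigma>" for X b
    using Cons.prems(1) by (intro find_cong) auto
  have "map_pmf (\<lambda>X. find X (e # \<sigma>)) (existing_edges S p) =
      bind_pmf (bernoulli_pmf (p e)) (\<lambda>b. bind_pmf (existing_edges (S - {e}) p)
        (\<lambda>X. return_pmf (if b then Some e else find X \<sigma>)))"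
    by (subst S) (simp add: map_bind_pmf upd cong: if_cong)
  also have "\<dots> = first_success p (e # \<sigma>)"
    using Cons.IH[of "S - {e}"] Cons.prems
    by (auto intro!: bind_pmf_cong simp: map_pmf_def subset_Diff_insert)
  finally show ?case .
qed

lemma set_first_success: "set_pmf (first_success p \<sigma>) \<subseteq> insert None (Some ` set \<sigma>)"
  by (induction \<sigma>) (auto split: if_splits)

text \<open>
  The candidate \<open>ca\<close> of an arriving vertex is the first edge of its query order for which the query or
  the coin that replaces it succeeds. Its law depends neither on the matching nor on the thresholds.
\<close>

definition commit ::
    "(('a, 'b) edge \<Rightarrow> real) \<Rightarrow> ('b \<Rightarrow> real) \<Rightarrow> real \<Rightarrow> ('a, 'b) edge set \<Rightarrow>
     ('a, 'b) edge option \<Rightarrow> ('a, 'b) edge set" where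
  "commit w c ta M ca = (case ca of None \<Rightarrow> M | Some e \<Rightarrow>
     if w e \<ge> (1 - exp (ta - 1)) * c (snd e) \<and> snd e \<notin> snd ` M then insert e M else M)"

primrec candidate_process ::
    "(('a, 'b) edge \<Rightarrow> real) \<Rightarrow> ('b \<Rightarrow> real) \<Rightarrow> ('a \<Rightarrow> real) \<Rightarrow> ('a \<Rightarrow> ('a, 'b) edge option pmf) \<Rightarrow>
     'a list \<Rightarrow> ('a, 'b) edge set \<Rightarrow> ('a, 'b) edge set pmf" where
  "candidate_process w c t \<xi> [] M = return_pmf M"
| "candidate_process w c t \<xi> (a # as) M =
     bind_pmf (\<xi> a) (\<lambda>ca. candidate_process w c t \<xi> as (commit w c (t a) M ca))"

text \<open>A query and the coin that replaces it both succeed with probability \<open>p e\<close>,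
  and either success ends the loop. They differ only in whether the edge joins the matching, which
  is what \<open>commit\<close> decides.\<close>

lemma run_fresh_inner:
  "run_fresh p (approx_QC_inner p w c ta M k \<sigma>) M =
   bind_pmf (first_success p \<sigma>) (\<lambda>ca. run_fresh p (k (commit w c ta M ca)) (commit w c ta M ca))"
proof (induction \<sigma>)
  case Nil
  then show ?case by (simp add: bind_return_pmf commit_def)
next
  case (Cons e \<sigma>)
  let ?acc = "w e \<ge> (1 - exp (ta - 1)) * c (snd e) \<and> snd e \<notin> snd ` M"
  have "run_fresh p (approx_QC_inner p w c ta M k (e # \<sigma>)) M =
      bind_pmf (bernoulli_pmf (p e)) (\<lambda>b.
        if b then run_fresh p (k (commit w c ta M (Some e))) (commit w c ta M (Some e))
        else run_fresh p (approx_QC_inner p w c ta M k \<sigma>) M)"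
  proof (cases ?acc)
    case True
    then have "commit w c ta M (Some e) = insert e M" by (simp add: commit_def)
    with True show ?thesis
      by (simp only: approx_QC_inner.simps if_True) (auto intro!: bind_pmf_cong)
  next
    case False
    then have "commit w c ta M (Some e) = M" by (simp only: commit_def option.case if_False)
    with False show ?thesis
      by (simp only: approx_QC_inner.simps if_False) (auto simp: bind_map_pmf intro!: bind_pmf_cong)
  qed
  also have "\<dots> = bind_pmf (first_success p (e # \<sigma>))
      (\<lambda>ca. run_fresh p (k (commit w c ta M ca)) (commit w c ta M ca))"
    by (auto simp: Cons bind_assoc_pmf bind_return_pmf intro!: bind_pmf_cong)
  finally show ?case .
qed

lemma run_fresh_outer:
  "run_fresh p (approx_QC_outer p w c D t as M) M =
   candidate_process w c t (\<lambda>a. bind_pmf (D a) (first_success p)) as M"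
proof (induction as arbitrary: M)
  case Nil
  then show ?case by simp
next
  case (Cons a as)
  then show ?case
    by (simp add: bind_map_pmf pmf.map_comp o_def run_fresh_inner bind_assoc_pmf)
qed

text \<open>The budget splits into the edges of the query order, spent by the loop, and
  \<open>S\<close>, reserved for the later vertices. Disjointness keeps \<open>S\<close> intact when
  an edge of the loop is queried.\<close>

lemma non_repeating_inner:
  assumes "distinct \<sigma>" "set \<sigma> \<inter> S = {}" "\<And>N. non_repeating S (k N)"
  shows "non_repeating (set \<sigma> \<union> S) (approx_QC_inner p w c ta M k \<sigma>)"
  using assms(1,2)
proof (induction \<sigma>)
  case Nil
  then show ?case using assms(3) by simp
next
  case (Cons e \<sigma>)
  have e: "(set (e # \<sigma>) \<union> S) - {e} = set \<sigma> \<union> S" using Cons.prems by auto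
  have k: "non_repeating (set \<sigma> \<union> S) (k N)" "non_repeating (set (e # \<sigma>) \<union> S) (k N)" for N
    using assms(3) by (auto intro: non_repeating_mono)
  have i: "non_repeating (set \<sigma> \<union> S) (approx_QC_inner p w c ta M k \<sigma>)"
    using Cons by auto
  \<comment> \<open>The coin branch spends nothing, so the tail is needed with the larger budget as
    well.\<close>
  then have "non_repeating (set (e # \<sigma>) \<union> S) (approx_QC_inner p w c ta M k \<sigma>)"
    by (rule non_repeating_mono) auto
  with k have "non_repeating (set (e # \<sigma>) \<union> S)
      (Flip (map_pmf (\<lambda>b. if b then k M else approx_QC_inner p w c ta M k \<sigma>) (bernoulli_pmf (p e))))"
    by (intro non_repeating.Flip) (simp only: set_map_pmf, erule imageE, simp del: set_simps)
  moreover have "non_repeating (set (e # \<sigma>) \<union> S)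
      (Query e (\<lambda>b. if b then k (insert e M) else approx_QC_inner p w c ta M k \<sigma>))"
    using i k by (intro non_repeating.Query) (simp, simp only: e split: if_split, blast)
  ultimately show ?case by simp
qed

lemma non_repeating_outer:
  assumes "distinct as"
    and "\<And>a \<sigma>. a \<in> set as \<Longrightarrow> \<sigma> \<in> set_pmf (D a) \<Longrightarrow> distinct \<sigma> \<and> set \<sigma> \<subseteq> delta_A E a"
  shows "non_repeating {e \<in> E. fst e \<in> set as} (approx_QC_outer p w c D t as M)"
  using assms
proof (induction as arbitrary: M)
  case Nil
  then show ?case by (simp add: non_repeating.Stop)
next
  case (Cons a as)
  let ?S = "{e \<in> E. fst e \<in> set as}"
  have k: "non_repeating ?S (approx_QC_outer p w c D t as N)" for N
    using Cons by auto
  have "non_repeating {e \<in> E. fst e \<in> set (a # as)}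
      (approx_QC_inner p w c (t a) M (approx_QC_outer p w c D t as) \<sigma>)"
    if "\<sigma> \<in> set_pmf (D a)" for \<sigma>
  proof -
    have "distinct \<sigma>" "set \<sigma> \<subseteq> delta_A E a" using Cons.prems(2) that by auto
    then show ?thesis
      using Cons.prems(1)
      by (intro non_repeating_mono[OF non_repeating_inner[of \<sigma> ?S, OF _ _ k]])
         (auto simp: delta_A_def)
  qed
  then show ?case by (auto intro!: non_repeating.Flip)
qed

lemma output_law_approx_QC_outer:
  assumes "finite E" "distinct as"
    and "\<And>a \<sigma>. a \<in> set as \<Longrightarrow> \<sigma> \<in> set_pmf (D a) \<Longrightarrow> distinct \<sigma> \<and> set \<sigma> \<subseteq> delta_A E a"
  shows "output_law E p (approx_QC_outer p w c D t as {}) =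
    candidate_process w c t (\<lambda>a. bind_pmf (D a) (first_success p)) as {}"
proof -
  have "non_repeating E (approx_QC_outer p w c D t as {})"
    using assms by (intro non_repeating_mono[OF non_repeating_outer[of as D E]]) auto
  then show ?thesis
    unfolding output_law_def
    using assms(1) by (subst bind_existing_edges_run) (simp_all add: run_fresh_outer)
qed

text \<open>The defining property of the query order distribution concerns edges sampled in advance;
  \<open>map_find_existing_edges\<close> transfers it to the coin model.\<close>

lemma pmf_candidate:
  assumes "finite E" "query_order_distribution E p x a Da"
  shows "pmf (bind_pmf Da (first_success p)) (Some e) = (if e \<in> delta_A E a then x e else 0)"
    and "set_pmf (bind_pmf Da (first_success p)) \<subseteq> insert None (Some ` delta_A E a)"
proof -
  have s: "distinct \<sigma> \<and> set \<sigma> \<subseteq> delta_A E a" if "\<sigma> \<in> set_pmf Da" for \<sigma>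
    using assms(2) that by (auto simp: query_order_distribution_def)
  then show sub: "set_pmf (bind_pmf Da (first_success p)) \<subseteq> insert None (Some ` delta_A E a)"
    by (auto dest!: set_first_success[THEN subsetD] s)
  have "bind_pmf Da (\<lambda>\<sigma>. map_pmf (\<lambda>X. find X \<sigma>) (existing_edges E p)) =
      bind_pmf Da (first_success p)"
    using s assms(1) by (intro bind_pmf_cong map_find_existing_edges) (auto simp: delta_A_def)
  then have "e \<in> delta_A E a \<Longrightarrow> pmf (bind_pmf Da (first_success p)) (Some e) = x e"
    using assms(2) by (simp add: query_order_distribution_def)
  moreover have "e \<notin> delta_A E a \<Longrightarrow> pmf (bind_pmf Da (first_success p)) (Some e) = 0"
    using sub by (auto simp: pmf_eq_0_set_pmf)
  ultimately show "pmf (bind_pmf Da (first_success p)) (Some e) = (if e \<in> delta_A E a then x e else 0)"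
    by simp
qed

section \<open>Decomposition of the expected weight into one single-item stopping problem per vertex
  of \<open>B\<close>\<close>

primrec threshold_value :: "('a \<Rightarrow> real) \<Rightarrow> ('a \<Rightarrow> real) \<Rightarrow> 'a list \<Rightarrow> real" where
  "threshold_value h v [] = 0"
| "threshold_value h v (a # as) = h a * v a + (1 - h a) * threshold_value h v as"

text \<open>The probability that \<open>a\<close>, arriving at time \<open>s\<close>, proposes the
  edge to \<open>b\<close> and passes its threshold. Whether \<open>b\<close> is still free is left
  to the recursion of \<open>threshold_value\<close>.\<close>

definition accept_prob ::
    "('a, 'b) edge set \<Rightarrow> (('a, 'b) edge \<Rightarrow> real) \<Rightarrow> ('b \<Rightarrow> real) \<Rightarrow> (('a, 'b) edge \<Rightarrow> real) \<Rightarrow>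
     'b \<Rightarrow> 'a \<Rightarrow> real \<Rightarrow> real" where
  "accept_prob E w c x b a s =
     (if (a, b) \<in> E \<and> (1 - exp (s - 1)) * c b \<le> w (a, b) then x (a, b) else 0)"

text \<open>The potential is the weight collected so far plus, for every free \<open>b\<close>, the
  value it can still expect. One candidate links the fates of different vertices of
  \<open>B\<close>, but it changes at most one summand, so linearity of expectation needs only the
  probabilities of the single candidates. Finiteness of the support is carried along because the
  expectation of a \<open>bind_pmf\<close> is expanded as a finite sum.\<close>

lemma expectation_candidate_process:
  assumes E: "finite E" "E \<subseteq> A \<times> B" and B: "finite B"
    and \<xi>: "\<And>a e. a \<in> set as \<Longrightarrow> pmf (\<xi> a) (Some e) = (if e \<in> delta_A E a then x e else 0)"
      "\<And>a. a \<in> set as \<Longrightarrow> set_pmf (\<xi> a) \<subseteq> insert None (Some ` delta_A E a)"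
    and M: "finite M"
  shows "finite (set_pmf (candidate_process w c t \<xi> as M)) \<and>
    measure_pmf.expectation (candidate_process w c t \<xi> as M) (\<lambda>M. \<Sum>e\<in>M. w e) =
      (\<Sum>e\<in>M. w e) + (\<Sum>b\<in>B - snd ` M.
         threshold_value (\<lambda>a. accept_prob E w c x b a (t a)) (\<lambda>a. w (a, b)) as)"
  using \<xi> M
proof (induction as arbitrary: M)
  case Nil
  then show ?case by simp
next
  case (Cons a as)
  let ?h = "\<lambda>b a. accept_prob E w c x b a (t a)"
  let ?V = "\<lambda>b. threshold_value (?h b) (\<lambda>a. w (a, b)) as"
  define \<Phi> where "\<Phi> N = (\<Sum>e\<in>N. w e) + (\<Sum>b\<in>B - snd ` N. ?V b)" for N
  let ?C = "\<lambda>ca. candidate_process w c t \<xi> as (commit w c (t a) M ca)"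
  let ?\<delta> = "delta_A E a"
  have fin_\<delta>: "finite ?\<delta>" using E(1) by (simp add: delta_A_def)
  have fin_commit: "finite (commit w c (t a) M ca)" for ca
    using Cons.prems(3) by (auto simp: commit_def split: option.split)
  have IH: "finite (set_pmf (?C ca))"
    "measure_pmf.expectation (?C ca) (\<lambda>M. \<Sum>e\<in>M. w e) = \<Phi> (commit w c (t a) M ca)" for ca
    using Cons.IH[OF Cons.prems(1,2) fin_commit] unfolding \<Phi>_def by auto
  have sub: "set_pmf (\<xi> a) \<subseteq> insert None (Some ` ?\<delta>)" using Cons.prems(2) by simp
  have fin: "finite (insert None (Some ` ?\<delta>))" using fin_\<delta> by simp
  have pS: "pmf (\<xi> a) (Some e) = x e" if "e \<in> ?\<delta>" for e
    using Cons.prems(1)[of a e] that by simp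
  have "(\<Sum>ca\<in>insert None (Some ` ?\<delta>). pmf (\<xi> a) ca) = 1"
    using sub fin by (intro sum_pmf_eq_1)
  \<comment> \<open>The missing mass belongs to \<open>None\<close>; it turns the average below into
    \<open>\<Phi> M\<close> plus the weighted changes of the potential.\<close>
  then have pN: "pmf (\<xi> a) None = 1 - (\<Sum>e\<in>?\<delta>. x e)"
    using fin_\<delta> by (subst (asm) sum.insert) (auto simp: sum.reindex pS)
  \<comment> \<open>An accepted candidate brings in its weight but forfeits the future value of its
    endpoint in \<open>B\<close>.\<close>
  have diff: "\<Phi> (commit w c (t a) M (Some e)) - \<Phi> M =
      (if w e \<ge> (1 - exp (t a - 1)) * c (snd e) \<and> snd e \<notin> snd ` M then w e - ?V (snd e) else 0)"
    if "e \<in> ?\<delta>" for e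
  proof (cases "w e \<ge> (1 - exp (t a - 1)) * c (snd e) \<and> snd e \<notin> snd ` M")
    case True
    have "snd e \<in> B - snd ` M" using that E(2) True by (auto simp: delta_A_def)
    then have "(\<Sum>b\<in>B - snd ` M. ?V b) = ?V (snd e) + (\<Sum>b\<in>B - snd ` M - {snd e}. ?V b)"
      using B by (intro sum.remove) auto
    moreover have "B - snd ` insert e M = B - snd ` M - {snd e}" by auto
    moreover have "e \<notin> M" using True by auto
    ultimately show ?thesis
      using True Cons.prems(3) by (simp add: \<Phi>_def commit_def)
  next
    case False
    then show ?thesis by (auto simp: commit_def)
  qed
  have "measure_pmf.expectation (candidate_process w c t \<xi> (a # as) M) (\<lambda>M. \<Sum>e\<in>M. w e) =
      (\<Sum>ca\<in>insert None (Some ` ?\<delta>). pmf (\<xi> a) ca * \<Phi> (commit w c (t a) M ca))"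
    unfolding candidate_process.simps
    by (subst pmf_expectation_bind[OF fin IH(1) sub]) (simp_all add: IH(2))
  also have "\<dots> = pmf (\<xi> a) None * \<Phi> M + (\<Sum>e\<in>?\<delta>. x e * \<Phi> (commit w c (t a) M (Some e)))"
    using fin_\<delta> by (subst sum.insert) (auto simp: sum.reindex pS commit_def)
  also have "\<dots> = \<Phi> M + (\<Sum>e\<in>?\<delta>. x e * (\<Phi> (commit w c (t a) M (Some e)) - \<Phi> M))"
    by (simp add: pN right_diff_distrib sum_subtractf left_diff_distrib flip: sum_distrib_right)
  also have "(\<Sum>e\<in>?\<delta>. x e * (\<Phi> (commit w c (t a) M (Some e)) - \<Phi> M)) =
      (\<Sum>e\<in>?\<delta>. if snd e \<notin> snd ` M then ?h (snd e) a * (w e - ?V (snd e)) else 0)"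
    by (intro sum.cong refl, subst diff) (auto simp: accept_prob_def delta_A_def)
  also have "\<dots> = (\<Sum>b\<in>snd ` ?\<delta>. if b \<notin> snd ` M then ?h b a * (w (a, b) - ?V b) else 0)"
    by (subst sum.reindex) (auto simp: delta_A_def inj_on_def intro!: sum.cong)
  \<comment> \<open>Vertices of \<open>B\<close> not adjacent to \<open>a\<close> have acceptance
    probability \<open>0\<close>, so they may be added to the sum.\<close>
  also have "\<dots> = (\<Sum>b\<in>B. if b \<notin> snd ` M then ?h b a * (w (a, b) - ?V b) else 0)"
    using E(2) B by (intro sum.mono_neutral_left)
      (auto simp: delta_A_def accept_prob_def image_iff split: if_splits)
  also have "\<dots> = (\<Sum>b\<in>B - snd ` M. ?h b a * (w (a, b) - ?V b))"
    using B by (simp add: sum.If_cases Diff_eq Compl_eq)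
  also have "\<Phi> M + \<dots> = (\<Sum>e\<in>M. w e) +
      (\<Sum>b\<in>B - snd ` M. threshold_value (?h b) (\<lambda>a. w (a, b)) (a # as))"
    by (simp add: \<Phi>_def flip: sum.distrib) (simp add: algebra_simps)
  finally show ?case
    using IH(1) finite_subset[OF sub fin] by simp
qed

text \<open>Unrolling the recursion, \<open>a\<close> is reached exactly when all its predecessors
  were declined. By asymmetry of \<open>R\<close>, the predecessors in the list are the elements
  below \<open>a\<close>, so the list order enters only through \<open>R\<close>.\<close>

lemma threshold_value_sorted:
  assumes "distinct as" "sorted_wrt R as" "\<And>a a'. R a a' \<Longrightarrow> \<not> R a' a"
  shows "threshold_value h v as =
    (\<Sum>a\<in>set as. h a * v a * (\<Prod>a'\<in>{a'\<in>set as. R a' a}. 1 - h a'))"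
  using assms(1,2)
proof (induction as)
  case Nil
  then show ?case by simp
next
  case (Cons a as)
  have a: "{a'\<in>set (a # as). R a' a} = {}"
    using Cons.prems(2) assms(3) by auto
  have z: "{a'\<in>set (a # as). R a' z} = insert a {a'\<in>set as. R a' z}" if "z \<in> set as" for z
    using Cons.prems(2) that by auto
  have "(\<Sum>z\<in>set as. h z * v z * (\<Prod>a'\<in>{a'\<in>set (a # as). R a' z}. 1 - h a')) =
      (1 - h a) * threshold_value h v as"
    using Cons by (auto simp: sum_distrib_left z simp del: set_simps intro!: sum.cong)
  moreover have "(\<Prod>a'\<in>{a'\<in>set (a # as). R a' a}. 1 - h a') = 1"
    by (simp only: a prod.empty)
  ultimately show ?case
    using Cons.prems(1) by (simp del: set_simps add: set_simps(2)[THEN arg_cong, of "sum _"])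
qed

text \<open>\<open>S\<close> is the order of the enumeration by which \<open>arrival_order\<close> breaks ties.\<close>

definition arrives_before :: "('a \<Rightarrow> 'a \<Rightarrow> bool) \<Rightarrow> ('a \<Rightarrow> real) \<Rightarrow> 'a \<Rightarrow> 'a \<Rightarrow> bool" where
  "arrives_before S t a' a \<longleftrightarrow> t a' < t a \<or> t a' = t a \<and> S a' a"

text \<open>\<open>insort_key\<close> places \<open>y\<close> in front of the elements with an equal
  key, and the second premise makes this the right tie-break.\<close>

lemma sorted_wrt_insort_key:
  "sorted_wrt (arrives_before S t) ys \<Longrightarrow> \<forall>z\<in>set ys. S y z \<Longrightarrow>
   sorted_wrt (arrives_before S t) (insort_key t y ys)"
proof (induction ys)
  case (Cons z zs)
  then show ?case
    by (auto simp: set_insort_key arrives_before_def)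
qed simp

lemma sorted_wrt_sort_key:
  "sorted_wrt S as \<Longrightarrow> sorted_wrt (arrives_before S t) (sort_key t as)"
proof (induction as)
  case (Cons a as)
  then have "sorted_wrt (arrives_before S t) (insort_key t a (sort_key t as))"
    by (intro sorted_wrt_insort_key) auto
  then show ?case by simp
qed simp

text \<open>The enumeration is chosen before the arrival times, so a single tie-breaking relation
  \<open>S\<close> serves all \<open>t\<close>.\<close>

lemma arrival_order_sorted:
  assumes "finite A"
  obtains S where "\<And>a a'. S a a' \<Longrightarrow> \<not> S a' a"
    and "\<And>t. distinct (arrival_order A t)" "\<And>t. set (arrival_order A t) = A"
    and "\<And>t. sorted_wrt (arrives_before S t) (arrival_order A t)"
proof -
  define L where "L = (SOME as. distinct as \<and> set as = A)"
  have L: "distinct L" "set L = A"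
    using someI_ex[of "\<lambda>as. distinct as \<and> set as = A"] finite_distinct_list[OF assms]
    unfolding L_def by blast+
  \<comment> \<open>Comparison of positions in the enumeration; distinctness makes it
    asymmetric.\<close>
  define S where "S u v \<longleftrightarrow> (\<exists>i j. i < j \<and> j < length L \<and> L ! i = u \<and> L ! j = v)" for u v
  have "sorted_wrt S L"
    by (auto simp: sorted_wrt_iff_nth_less S_def)
  moreover have "\<not> S v u" if "S u v" for u v
  proof
    assume "S v u"
    with that obtain i j i' j' where *: "i < j" "j < length L" "L ! i = u" "L ! j = v"
      "i' < j'" "j' < length L" "L ! i' = v" "L ! j' = u"
      by (auto simp: S_def)
    with L(1) have "i = j'" "j = i'"
      by (metis nth_eq_iff_index_eq order.strict_trans)+
    with * show False by simp
  qed
  ultimately show thesis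
    using L by (intro that[of S]) (auto simp: arrival_order_def L_def[symmetric] sorted_wrt_sort_key)
qed

section \<open>The prophet secretary bound\<close>

text \<open>The threshold decreases with time, so a fixed value is accepted from some moment
  on.\<close>

lemma threshold_time_exists:
  fixes c v :: real
  assumes "0 < c" "0 \<le> v"
  shows "\<exists>\<theta>. 0 \<le> \<theta> \<and> \<theta> \<le> 1 \<and> (\<forall>s\<in>{0..1}. (1 - exp (s - 1)) * c \<le> v \<longleftrightarrow> \<theta> \<le> s)"
proof (cases "v < c")
  case True
  \<comment> \<open>The solution of \<open>(1 - exp (\<theta> - 1)) * c = v\<close>, cut off at time
    \<open>0\<close>.\<close>
  define \<theta> where "\<theta> = max 0 (1 + ln (1 - v / c))"
  have pos: "1 - v / c > 0" using assms True by simp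
  then have "ln (1 - v / c) \<le> 0" using assms by (simp add: ln_le_zero_iff)
  moreover have "(1 - exp (s - 1)) * c \<le> v \<longleftrightarrow> \<theta> \<le> s" if "s \<in> {0..1}" for s
  proof -
    have "(1 - exp (s - 1)) * c \<le> v \<longleftrightarrow> 1 - v / c \<le> exp (s - 1)"
      using assms by (simp add: field_simps)
    also have "\<dots> \<longleftrightarrow> ln (1 - v / c) \<le> s - 1"
      using pos by (metis exp_ln exp_le_cancel_iff)
    finally show ?thesis using that by (auto simp: \<theta>_def)
  qed
  ultimately show ?thesis by (intro exI[of _ \<theta>]) (auto simp: \<theta>_def)
next
  case False
  have "(1 - exp (s - 1)) * c \<le> v" for s
  proof -
    have "(1 - exp (s - 1)) * c \<le> 1 * c" using assms by (intro mult_right_mono) auto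
    then show ?thesis using False by simp
  qed
  then show ?thesis by (intro exI[of _ 0]) auto
qed

text \<open>
  The integrand splits each accepted weight \<open>v a\<close> into the threshold \<open>\<tau> s = (1 - exp (s - 1)) * c\<close> and
  the surplus \<open>v a - \<tau> s\<close>. With \<open>r s\<close> the probability of still being free at time \<open>s\<close>, the thresholds
  contribute \<open>- \<tau> s * r' s\<close> and the surpluses at least \<open>r s * (c - \<tau> s) = - r s * \<tau>' s\<close>, so the integrand
  dominates the derivative of \<open>- \<tau> * r\<close>.
\<close>

lemma threshold_integral_ge:
  fixes v x \<theta> :: "'a \<Rightarrow> real"
  assumes fin: "finite A" and x: "\<And>a. a \<in> A \<Longrightarrow> 0 \<le> x a" "sum x A \<le> 1"
    and v: "\<And>a. a \<in> A \<Longrightarrow> 0 \<le> v a" and c: "c = (\<Sum>a\<in>A. x a * v a)"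
    and \<theta>: "\<And>a. a \<in> A \<Longrightarrow> 0 \<le> \<theta> a"
      "\<And>a s. a \<in> A \<Longrightarrow> s \<in> {0..1} \<Longrightarrow> (1 - exp (s - 1)) * c \<le> v a \<longleftrightarrow> \<theta> a \<le> s"
    and int: "((\<lambda>s. \<Sum>a\<in>A. x a * of_bool (\<theta> a \<le> s) * v a *
        (\<Prod>a'\<in>A - {a}. 1 - x a' * max 0 (s - \<theta> a'))) has_integral I) {0..1}"
  shows "(1 - 1 / exp 1) * c \<le> I"
proof -
  \<comment> \<open>The probability that \<open>a\<close> has arrived by time \<open>s\<close> with
    an accepted candidate; \<open>R a s\<close> is the probability that nobody other than
    \<open>a\<close> has.\<close>
  define q where "q a s = x a * max 0 (s - \<theta> a)" for a s
  define r where "r s = (\<Prod>a\<in>A. 1 - q a s)" for s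
  define R where "R a s = (\<Prod>a'\<in>A - {a}. 1 - q a' s)" for a s
  define F where "F s = (exp (s - 1) - 1) * c * r s" for s
  define F' where "F' s = exp (s - 1) * c * r s +
    (exp (s - 1) - 1) * c * (\<Sum>a\<in>A. - (x a * of_bool (\<theta> a \<le> s)) * R a s)" for s
  have c0: "0 \<le> c" unfolding c using x(1) v by (intro sum_nonneg) auto
  have cont: "continuous_on {0..1} F"
    unfolding F_def r_def q_def by (intro continuous_intros)
  have der: "(F has_vector_derivative F' s) (at s)" if s: "s \<in> {0<..<1} - \<theta> ` A" for s
  proof -
    have q: "(q a has_real_derivative x a * of_bool (\<theta> a \<le> s)) (at s)" if a: "a \<in> A" for a
    proof (cases "\<theta> a < s")
      case True
      have "((\<lambda>s. x a * (s - \<theta> a)) has_real_derivative x a) (at s)"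
        by (auto intro!: derivative_eq_intros)
      moreover have ev: "\<forall>\<^sub>F u in nhds s. x a * (u - \<theta> a) = q a u"
        by (rule eventually_mono[OF eventually_nhds_in_open[OF open_greaterThan[of "\<theta> a"]]])
           (use True in \<open>auto simp: q_def\<close>)
      ultimately show ?thesis
        using True DERIV_cong_ev[OF refl ev refl] by simp
    next
      case False
      then have lt: "s < \<theta> a" using s a by force
      have "((\<lambda>s. 0) has_real_derivative 0) (at s)" by simp
      moreover have ev: "\<forall>\<^sub>F u in nhds s. 0 = q a u"
        by (rule eventually_mono[OF eventually_nhds_in_open[OF open_lessThan[of "\<theta> a"]]])
           (use lt in \<open>auto simp: q_def\<close>)
      ultimately show ?thesis
        using lt DERIV_cong_ev[OF refl ev refl] by simp
    qed
    have "(r has_real_derivative (\<Sum>a\<in>A. - (x a * of_bool (\<theta> a \<le> s)) * R a s)) (at s)"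
      unfolding r_def R_def
      by (rule DERIV_cong[OF has_field_derivative_prod]) (auto intro!: derivative_eq_intros q)
    then have "(F has_real_derivative F' s) (at s)"
      unfolding F_def F'_def by (auto intro!: derivative_eq_intros)
    then show ?thesis by (simp add: has_real_derivative_iff_has_vector_derivative)
  qed
  \<comment> \<open>\<open>F\<close> is continuous and fails to be differentiable at most at the
    finitely many kinks \<open>\<theta> a\<close>, which this form of the fundamental theorem
    tolerates.\<close>
  have FTC: "(F' has_integral (F 1 - F 0)) {0..1}"
    by (rule fundamental_theorem_of_calculus_interior_strong[of "\<theta> ` A"]) (use fin der cont in auto)
  have q01: "0 \<le> q a s \<and> q a s \<le> 1" if "a \<in> A" "s \<in> {0..1}" for a s
  proof -
    have "x a \<le> sum x A" using fin x(1) that(1) by (intro member_le_sum) auto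
    then have "x a \<le> 1" using x(2) by simp
    then show ?thesis unfolding q_def
      using x(1)[OF that(1)] \<theta>(1)[OF that(1)] that(2) by (auto intro!: mult_le_one)
  qed
  have "F' s \<le> (\<Sum>a\<in>A. x a * of_bool (\<theta> a \<le> s) * v a * R a s)" if s: "s \<in> {0..1}" for s
  proof -
    define \<tau> where "\<tau> = (1 - exp (s - 1)) * c"
    have \<tau>0: "0 \<le> \<tau>" unfolding \<tau>_def using s c0 by (intro mult_nonneg_nonneg) auto
    have r0: "0 \<le> r s" unfolding r_def using q01 s by (intro prod_nonneg) auto
    \<comment> \<open>An accepted surplus is nonnegative and \<open>r s \<le> R a s\<close>; a
      rejected one is negative and may be replaced by \<open>0\<close>.\<close>
    have surplus: "x a * (v a - \<tau>) * r s \<le> x a * of_bool (\<theta> a \<le> s) * (v a - \<tau>) * R a s"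
      if a: "a \<in> A" for a
    proof (cases "\<theta> a \<le> s")
      case True
      then have ge: "0 \<le> v a - \<tau>" using \<theta>(2)[OF a s] by (simp add: \<tau>_def)
      have R0: "0 \<le> R a s" unfolding R_def using q01 s by (intro prod_nonneg) auto
      have "r s = (1 - q a s) * R a s"
        unfolding r_def R_def using fin a by (rule prod.remove)
      also have "\<dots> \<le> R a s"
        using R0 q01[OF a s] by (intro mult_left_le_one_le) auto
      finally have "x a * (v a - \<tau>) * r s \<le> x a * (v a - \<tau>) * R a s"
        using ge x(1)[OF a] by (intro mult_left_mono) auto
      then show ?thesis using True by simp
    next
      case False
      then have "v a - \<tau> < 0" using \<theta>(2)[OF a s] by (simp add: \<tau>_def)
      then have "x a * (v a - \<tau>) * r s \<le> 0"
        using x(1)[OF a] r0 by (intro mult_nonpos_nonneg mult_nonneg_nonpos) auto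
      then show ?thesis using False by simp
    qed
    have "exp (s - 1) * c * r s = (c - \<tau>) * r s" by (simp add: \<tau>_def algebra_simps)
    \<comment> \<open>Here the total candidate probability being at most \<open>1\<close> is used,
      together with \<open>0 \<le> \<tau>\<close>.\<close>
    also have "\<dots> \<le> (c - \<tau> * sum x A) * r s"
      using r0 mult_left_mono[OF x(2) \<tau>0] by (intro mult_right_mono) auto
    also have "\<dots> = (\<Sum>a\<in>A. x a * (v a - \<tau>) * r s)"
      unfolding c sum_distrib_left sum_subtractf[symmetric] sum_distrib_right
      by (intro sum.cong) (auto simp: algebra_simps)
    also have "\<dots> \<le> (\<Sum>a\<in>A. x a * of_bool (\<theta> a \<le> s) * (v a - \<tau>) * R a s)"
      by (intro sum_mono surplus)
    also have "\<dots> = (\<Sum>a\<in>A. x a * of_bool (\<theta> a \<le> s) * v a * R a s) -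
        \<tau> * (\<Sum>a\<in>A. x a * of_bool (\<theta> a \<le> s) * R a s)"
      unfolding sum_distrib_left sum_subtractf[symmetric]
      by (intro sum.cong) (auto simp: algebra_simps)
    finally show ?thesis
      by (simp add: F'_def \<tau>_def sum_negf algebra_simps)
  qed
  then have "F 1 - F 0 \<le> I"
    using int by (intro has_integral_le[OF FTC, of _ I]) (auto simp: R_def q_def)
  \<comment> \<open>The threshold vanishes at time \<open>1\<close>, so \<open>F 1 = 0\<close>, and
    at time \<open>0\<close> nothing has been accepted yet; hence \<open>F 1 - F 0\<close> is the
    claimed bound.\<close>
  moreover have "r 0 = 1"
    unfolding r_def q_def using \<theta>(1) by (intro prod.neutral) auto
  ultimately show ?thesis
    by (simp add: F_def exp_minus field_simps)
qed

section \<open>Integration over independent uniform arrival times\<close>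

abbreviation (input) unif01 :: "real measure" where
  "unif01 \<equiv> uniform_measure lborel {0..1}"

lemma prob_space_unif01: "prob_space unif01"
  by (intro prob_space_uniform_measure) auto

lemma unif01_density: "unif01 = density lborel (\<lambda>u. ennreal (indicator {0..1} u))"
  by (simp add: uniform_measure_def divide_ennreal_def ennreal_indicator)

lemma integral_unif01:
  fixes f :: "real \<Rightarrow> real"
  assumes [measurable]: "f \<in> borel_measurable borel"
  shows "integral\<^sup>L unif01 f = (\<integral>u. indicator {0..1} u * f u \<partial>lborel)"
  by (simp add: unif01_density integral_density)

lemma has_integral_unif01:
  fixes f :: "real \<Rightarrow> real"
  assumes "integrable unif01 f"
  shows "(f has_integral integral\<^sup>L unif01 f) {0..1}"
proof -
  have m[measurable]: "f \<in> borel_measurable borel"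
    using borel_measurable_integrable[OF assms]
    by (simp add: measurable_cong_sets[OF sets_uniform_measure refl])
  have i: "set_integrable lborel {0..1} f"
    using assms by (simp add: unif01_density integrable_density set_integrable_def)
  then show ?thesis
    using set_borel_integral_eq_integral[OF i] integrable_integral
    by (simp add: integral_unif01 set_lebesgue_integral_def)
qed

text \<open>The acceptance times before \<open>s\<close> form an interval inside the unit interval.
  The flag \<open>b\<close> decides whether \<open>s\<close> itself belongs to it, which does not
  change its length.\<close>

lemma integral_unif01_threshold:
  assumes "0 \<le> \<theta>" "s \<in> {0..1}"
    and "\<And>u. u \<in> {0..1} \<Longrightarrow> f u = x * of_bool (\<theta> \<le> u \<and> (u < s \<or> u = s \<and> b))"
    and [measurable]: "f \<in> borel_measurable borel"
  shows "integral\<^sup>L unif01 f = x * max 0 (s - \<theta>)"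
proof -
  let ?X = "if b then {\<theta>..s} else {\<theta>..<s}"
  have "integral\<^sup>L unif01 f = (\<integral>u. x * indicator ?X u \<partial>lborel)"
    unfolding integral_unif01[OF assms(4)]
    using assms(1-3) by (intro Bochner_Integration.integral_cong) (auto simp: indicator_def)
  also have "\<dots> = x * measure lborel ?X" by simp
  also have "measure lborel ?X = max 0 (s - \<theta>)" by (simp add: max_def)
  finally show ?thesis .
qed

text \<open>Conditioning on coordinate \<open>a\<close>: once \<open>t a = s\<close> is fixed, the
  other coordinates are independent and the integral of the product factorises. The uniform bounds
  supply the integrability that Fubini requires.\<close>

lemma (in prob_space) integral_PiM_prod_coordinate:
  fixes f :: "'i \<Rightarrow> 'a \<Rightarrow> 'a \<Rightarrow> real"
  assumes A: "finite A" "a \<in> A"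
    and g[measurable]: "g \<in> borel_measurable M" and gK: "\<And>s. \<bar>g s\<bar> \<le> K"
    and f[measurable]: "\<And>i. (\<lambda>(u, s). f i u s) \<in> borel_measurable (M \<Otimes>\<^sub>M M)"
    and f1: "\<And>i u s. i \<in> A \<Longrightarrow> \<bar>f i u s\<bar> \<le> 1"
  shows "integrable (PiM A (\<lambda>_. M)) (\<lambda>t. g (t a) * (\<Prod>i\<in>A - {a}. f i (t i) (t a)))"
    and "(\<integral>t. g (t a) * (\<Prod>i\<in>A - {a}. f i (t i) (t a)) \<partial>PiM A (\<lambda>_. M)) =
      (\<integral>s. g s * (\<Prod>i\<in>A - {a}. \<integral>u. f i u s \<partial>M) \<partial>M)"
    and "integrable M (\<lambda>s. g s * (\<Prod>i\<in>A - {a}. \<integral>u. f i u s \<partial>M))"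
proof -
  let ?I = "A - {a}"
  interpret P: product_sigma_finite "\<lambda>_::'i. M" ..
  interpret Q: prob_space "PiM ?I (\<lambda>_. M)" by (intro prob_space_PiM) (rule prob_space_axioms)
  interpret QA: prob_space "PiM A (\<lambda>_. M)" by (intro prob_space_PiM) (rule prob_space_axioms)
  interpret QM: pair_prob_space "PiM ?I (\<lambda>_. M)" M ..
  have ins: "insert a ?I = A" using A(2) by auto
  have bound: "\<bar>g s * (\<Prod>i\<in>?I. f i (t i) s)\<bar> \<le> K" for s t
  proof -
    have "\<bar>g s\<bar> * \<bar>\<Prod>i\<in>?I. f i (t i) s\<bar> \<le> K * 1"
      using gK[of s] f1 by (intro mult_mono) (auto simp: abs_prod intro!: prod_le_1 prod_nonneg)
    then show ?thesis by (simp add: abs_mult)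
  qed
  show int: "integrable (PiM A (\<lambda>_. M)) (\<lambda>t. g (t a) * (\<Prod>i\<in>?I. f i (t i) (t a)))"
  proof (rule QA.integrable_const_bound[where B = K])
    have [measurable]: "(\<lambda>t. t i) \<in> measurable (PiM A (\<lambda>_. M)) M" if "i \<in> A" for i
      using that by (rule measurable_component_singleton)
    have "(\<lambda>t. f i (t i) (t a)) \<in> borel_measurable (PiM A (\<lambda>_. M))" if "i \<in> A" for i
      using measurable_compose[OF measurable_Pair f[of i], of "\<lambda>t. t i" "PiM A (\<lambda>_. M)" "\<lambda>t. t a"] that A(2)
      by simp
    then show "(\<lambda>t. g (t a) * (\<Prod>i\<in>?I. f i (t i) (t a))) \<in> borel_measurable (PiM A (\<lambda>_. M))"
      using A(2) by (intro borel_measurable_times borel_measurable_prod) auto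
  qed (use bound in auto)
  have joint: "(\<lambda>(t, s). g s * (\<Prod>i\<in>?I. f i (t i) s)) \<in> borel_measurable (PiM ?I (\<lambda>_. M) \<Otimes>\<^sub>M M)"
  proof -
    have "(\<lambda>z. f i (fst z i) (snd z)) \<in> borel_measurable (PiM ?I (\<lambda>_. M) \<Otimes>\<^sub>M M)" if "i \<in> ?I" for i
    proof -
      have "(\<lambda>z. fst z i) \<in> measurable (PiM ?I (\<lambda>_. M) \<Otimes>\<^sub>M M) M"
        using measurable_compose[OF measurable_fst measurable_component_singleton[OF that]] .
      from measurable_compose[OF measurable_Pair[OF this measurable_snd] f[of i]]
      show ?thesis by simp
    qed
    then show ?thesis
      unfolding case_prod_beta' by (intro borel_measurable_times borel_measurable_prod) auto
  qed
  have int2: "integrable (PiM ?I (\<lambda>_. M) \<Otimes>\<^sub>M M) (\<lambda>(t, s). g s * (\<Prod>i\<in>?I. f i (t i) s))"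
    by (rule QM.P.integrable_const_bound[where B = K]) (use bound joint in auto)
  have fsec: "(\<lambda>u. f i u s) \<in> borel_measurable M" if "s \<in> space M" for i s
    using measurable_compose[OF measurable_Pair[OF measurable_ident_sets[OF refl] measurable_const[OF that]] f[of i]]
    by simp
  have prod: "(\<integral>t. g s * (\<Prod>i\<in>?I. f i (t i) s) \<partial>PiM ?I (\<lambda>_. M)) =
      g s * (\<Prod>i\<in>?I. \<integral>u. f i u s \<partial>M)" if "s \<in> space M" for s
  proof -
    have "(\<integral>t. (\<Prod>i\<in>?I. f i (t i) s) \<partial>PiM ?I (\<lambda>_. M)) = (\<Prod>i\<in>?I. \<integral>u. f i u s \<partial>M)"
      using A(1) fsec[OF that] f1
      by (intro P.product_integral_prod integrable_const_bound[where B = 1]) auto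
    then show ?thesis by simp
  qed
  have upd: "(\<Prod>i\<in>?I. f i ((t(a := s)) i) s') = (\<Prod>i\<in>?I. f i (t i) s')" for t s s'
    by (intro prod.cong) auto
  have "(\<integral>t. g (t a) * (\<Prod>i\<in>?I. f i (t i) (t a)) \<partial>PiM A (\<lambda>_. M)) =
      (\<integral>t. \<integral>s. g s * (\<Prod>i\<in>?I. f i (t i) s) \<partial>M \<partial>PiM ?I (\<lambda>_. M))"
    using P.product_integral_insert[of ?I a, unfolded ins, OF _ _ int] A(1) by (simp add: upd del: fun_upd_apply) (simp only: fun_upd_same)
  also have "\<dots> = (\<integral>s. \<integral>t. g s * (\<Prod>i\<in>?I. f i (t i) s) \<partial>PiM ?I (\<lambda>_. M) \<partial>M)"
    using QM.Fubini_integral[OF int2] by simp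
  also have "\<dots> = (\<integral>s. g s * (\<Prod>i\<in>?I. \<integral>u. f i u s \<partial>M) \<partial>M)"
    by (intro Bochner_Integration.integral_cong refl prod)
  finally show "(\<integral>t. g (t a) * (\<Prod>i\<in>?I. f i (t i) (t a)) \<partial>PiM A (\<lambda>_. M)) =
      (\<integral>s. g s * (\<Prod>i\<in>?I. \<integral>u. f i u s \<partial>M) \<partial>M)" .
  have "integrable M (\<lambda>s. \<integral>t. g s * (\<Prod>i\<in>?I. f i (t i) s) \<partial>PiM ?I (\<lambda>_. M)) \<longleftrightarrow>
      integrable M (\<lambda>s. g s * (\<Prod>i\<in>?I. \<integral>u. f i u s \<partial>M))"
    by (intro Bochner_Integration.integrable_cong refl prod)
  then show "integrable M (\<lambda>s. g s * (\<Prod>i\<in>?I. \<integral>u. f i u s \<partial>M))"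
    using QM.integrable_snd[OF int2] by blast
qed

lemma borel_measurable_unif01:
  "borel_measurable unif01 = borel_measurable borel"
  "borel_measurable (unif01 \<Otimes>\<^sub>M unif01) = borel_measurable (borel \<Otimes>\<^sub>M borel)"
  by (auto intro!: measurable_cong_sets sets_pair_measure_cong)

text \<open>Given that \<open>a\<close> arrives at \<open>s\<close>, each other vertex
  \<open>i\<close> leaves the item free with probability
  \<open>1 - x i * max 0 (s - \<theta> i)\<close>, independently of the rest. This gives the
  integrand of \<open>threshold_integral_ge\<close>.\<close>

lemma threshold_policy_expectation:
  fixes v x :: "'a \<Rightarrow> real" and h :: "'a \<Rightarrow> real \<Rightarrow> real"
  assumes fin: "finite A" and x: "\<And>a. a \<in> A \<Longrightarrow> 0 \<le> x a" "sum x A \<le> 1"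
    and v: "\<And>a. a \<in> A \<Longrightarrow> 0 \<le> v a" and c: "c = (\<Sum>a\<in>A. x a * v a)"
    and S: "\<And>a a'. S a a' \<Longrightarrow> \<not> S a' a"
    and h: "\<And>a s. h a s = (if (1 - exp (s - 1)) * c \<le> v a then x a else 0)"
  defines "gain \<equiv> \<lambda>t. \<Sum>a\<in>A. h a (t a) * v a *
    (\<Prod>a'\<in>{a'\<in>A. arrives_before S t a' a}. 1 - h a' (t a'))"
  shows "integrable (arrival_times A) gain"
    and "(1 - 1 / exp 1) * c \<le> (\<integral>t. gain t \<partial>arrival_times A)"
proof -
  interpret U: prob_space unif01 by (rule prob_space_unif01)
  \<comment> \<open>The factor by which \<open>i\<close>, arriving at \<open>u\<close>, reduces the
    chance of \<open>a\<close>, arriving at \<open>s\<close>. Ties are included so that the product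
    formula for \<open>gain\<close> holds for every \<open>t\<close>, not just almost
    surely.\<close>
  define f where "f a i u s = 1 - h i u * (if u < s \<or> u = s \<and> S i a then 1 else 0)" for a i u s
  have x1: "x a \<le> 1" if "a \<in> A" for a
    using member_le_sum[of a A x] fin x that by force
  have f01: "0 \<le> f a i u s" "f a i u s \<le> 1" if "i \<in> A" for a i u s
    using x(1)[OF that] x1[OF that] by (auto simp: f_def h)
  have hm[measurable]: "h a \<in> borel_measurable borel" for a
    unfolding h by measurable
  have fm: "(\<lambda>(u, s). f a i u s) \<in> borel_measurable (borel \<Otimes>\<^sub>M borel)" for a i
    unfolding f_def by measurable
  have fm1: "(\<lambda>u. f a i u s) \<in> borel_measurable borel" for a i s
    unfolding f_def by measurable
  have gain: "gain t = (\<Sum>a\<in>A. (h a (t a) * v a) * (\<Prod>i\<in>A - {a}. f a i (t i) (t a)))" for t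
  proof -
    have "(\<Prod>a'\<in>{a'\<in>A. arrives_before S t a' a}. 1 - h a' (t a')) =
        (\<Prod>i\<in>A - {a}. f a i (t i) (t a))" if "a \<in> A" for a
    proof -
      have "\<not> S a a" using S by blast
      then have "{a'\<in>A. arrives_before S t a' a} = {i \<in> A - {a}. t i < t a \<or> t i = t a \<and> S i a}"
        by (auto simp: arrives_before_def)
      then have "(\<Prod>a'\<in>{a'\<in>A. arrives_before S t a' a}. 1 - h a' (t a')) =
          (\<Prod>i\<in>{i \<in> A - {a}. t i < t a \<or> t i = t a \<and> S i a}. 1 - h i (t i))"
        by (rule arg_cong)
      also have "\<dots> = (\<Prod>i\<in>A - {a}. if t i < t a \<or> t i = t a \<and> S i a then 1 - h i (t i) else 1)"
        using fin by (intro prod.inter_filter) auto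
      also have "\<dots> = (\<Prod>i\<in>A - {a}. f a i (t i) (t a))"
        by (intro prod.cong) (auto simp: f_def)
      finally show ?thesis .
    qed
    then show ?thesis by (simp add: gain_def)
  qed
  have vK: "\<bar>h a s * v a\<bar> \<le> v a" if "a \<in> A" for a s
    using x(1)[OF that] x1[OF that] v[OF that] by (auto simp: h abs_mult intro!: mult_left_le_one_le)
  note coord = U.integral_PiM_prod_coordinate[OF fin, where g = "\<lambda>s. h a s * v a" and f = "f a" and K = "v a" for a,
      unfolded borel_measurable_unif01]
  have coord1: "integrable (PiM A (\<lambda>_. unif01)) (\<lambda>t. (h a (t a) * v a) * (\<Prod>i\<in>A - {a}. f a i (t i) (t a)))"
    "(\<integral>t. (h a (t a) * v a) * (\<Prod>i\<in>A - {a}. f a i (t i) (t a)) \<partial>PiM A (\<lambda>_. unif01)) =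
      (\<integral>s. h a s * v a * (\<Prod>i\<in>A - {a}. \<integral>u. f a i u s \<partial>unif01) \<partial>unif01)"
    "integrable unif01 (\<lambda>s. h a s * v a * (\<Prod>i\<in>A - {a}. \<integral>u. f a i u s \<partial>unif01))"
    if "a \<in> A" for a
    by (rule coord; use that vK fm f01 hm in \<open>auto\<close>)+
  show int: "integrable (arrival_times A) gain"
    unfolding gain arrival_times_def using coord1(1) by (intro Bochner_Integration.integrable_sum)
  show "(1 - 1 / exp 1) * c \<le> (\<integral>t. gain t \<partial>arrival_times A)"
  \<comment> \<open>Threshold times are available only for positive \<open>c\<close>; for
    \<open>c = 0\<close> it is enough that the gain is nonnegative.\<close>
  proof (cases "c = 0")
    case True
    have "0 \<le> gain t" for t
      unfolding gain using x v f01 by (intro sum_nonneg mult_nonneg_nonneg prod_nonneg) (auto simp: h)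
    then show ?thesis using True by simp
  next
    case False
    have "0 \<le> c" unfolding c using x(1) v by (intro sum_nonneg) auto
    with False have "0 < c" by simp
    then have "\<forall>a\<in>A. \<exists>\<theta>. 0 \<le> \<theta> \<and> \<theta> \<le> 1 \<and> (\<forall>s\<in>{0..1}. (1 - exp (s - 1)) * c \<le> v a \<longleftrightarrow> \<theta> \<le> s)"
      using threshold_time_exists v by blast
    from bchoice[OF this] obtain \<theta> where "\<forall>a\<in>A. 0 \<le> \<theta> a \<and> \<theta> a \<le> 1 \<and>
        (\<forall>s\<in>{0..1}. (1 - exp (s - 1)) * c \<le> v a \<longleftrightarrow> \<theta> a \<le> s)" ..
    then have \<theta>: "\<And>a. a \<in> A \<Longrightarrow> 0 \<le> \<theta> a"
      "\<And>a s. a \<in> A \<Longrightarrow> s \<in> {0..1} \<Longrightarrow> (1 - exp (s - 1)) * c \<le> v a \<longleftrightarrow> \<theta> a \<le> s"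
      by blast+
    have f_int: "(\<integral>u. f a i u s \<partial>unif01) = 1 - x i * max 0 (s - \<theta> i)"
      if "i \<in> A" "s \<in> {0..1}" for a i s
    proof -
      have fi: "integrable unif01 (\<lambda>u. f a i u s)"
        using f01[OF that(1)] fm1
        by (intro U.integrable_const_bound[where B = 1]) (auto simp: borel_measurable_unif01)
      have "(\<integral>u. 1 - f a i u s \<partial>unif01) = x i * max 0 (s - \<theta> i)"
        using \<theta> that fm1
        by (intro integral_unif01_threshold[where b = "S i a"]) (auto simp: f_def h)
      moreover have "(\<integral>u. 1 - f a i u s \<partial>unif01) = 1 - (\<integral>u. f a i u s \<partial>unif01)"
        using fi U.prob_space by (subst Bochner_Integration.integral_diff) auto
      ultimately show ?thesis by simp
    qed
    let ?I = "\<integral>t. gain t \<partial>arrival_times A"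
    have "((\<lambda>s. \<Sum>a\<in>A. h a s * v a * (\<Prod>i\<in>A - {a}. \<integral>u. f a i u s \<partial>unif01)) has_integral
        (\<Sum>a\<in>A. \<integral>s. h a s * v a * (\<Prod>i\<in>A - {a}. \<integral>u. f a i u s \<partial>unif01) \<partial>unif01)) {0..1}"
      using fin coord1(3) by (intro has_integral_sum has_integral_unif01)
    also have "(\<Sum>a\<in>A. \<integral>s. h a s * v a * (\<Prod>i\<in>A - {a}. \<integral>u. f a i u s \<partial>unif01) \<partial>unif01) = ?I"
      unfolding gain arrival_times_def using coord1(1,2)
      by (subst Bochner_Integration.integral_sum) auto
    finally have "((\<lambda>s. \<Sum>a\<in>A. x a * of_bool (\<theta> a \<le> s) * v a *
        (\<Prod>i\<in>A - {a}. 1 - x i * max 0 (s - \<theta> i))) has_integral ?I) {0..1}"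
      by (rule has_integral_eq[rotated])
         (auto intro!: sum.cong prod.cong simp: f_int h \<theta>(2))
    from threshold_integral_ge[OF fin x v c \<theta> this] show ?thesis .
  qed
qed

section \<open>From fixed arrival times to the comparison with \<open>OPT\<close>\<close>

lemma expected_weight_approx_QC:
  fixes A :: "'a set" and B :: "'b set" and w p x :: "'a \<times> 'b \<Rightarrow> real"
  assumes fin: "finite E" "finite B" and sub: "E \<subseteq> A \<times> B"
    and D: "\<And>a. a \<in> A \<Longrightarrow> query_order_distribution E p x a (D a)"
    and ord: "distinct (arrival_order A t)" "set (arrival_order A t) = A"
  shows "measure_pmf.expectation (output_law E p (approx_QC A E p w x D t)) (\<lambda>M. \<Sum>e\<in>M. w e) =
    (\<Sum>b\<in>B. threshold_value
      (\<lambda>a. accept_prob E w (\<lambda>b. \<Sum>e\<in>delta_B E b. x e * w e) x b a (t a)) (\<lambda>a. w (a, b))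
      (arrival_order A t))"
proof -
  let ?\<xi> = "\<lambda>a. bind_pmf (D a) (first_success p)"
  have "output_law E p (approx_QC A E p w x D t) =
      candidate_process w (\<lambda>b. \<Sum>e\<in>delta_B E b. x e * w e) t ?\<xi> (arrival_order A t) {}"
    unfolding approx_QC_def
    using D ord fin(1)
    by (intro output_law_approx_QC_outer) (auto simp: query_order_distribution_def)
  then show ?thesis
    using expectation_candidate_process[OF fin(1) sub fin(2), of "arrival_order A t" ?\<xi> x "{}"]
      pmf_candidate[OF fin(1) D] ord
    by simp
qed

theorem theorem1:
  fixes A :: "'a set" and B :: "'b set" and E :: "('a \<times> 'b) set" and n :: nat
    and w p x :: "'a \<times> 'b \<Rightarrow> real" and D :: "'a \<Rightarrow> ('a \<times> 'b) list pmf"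
  assumes "finite A" and "finite B" and "card A = n" and "card B = n"
    and "E \<subseteq> A \<times> B"
    and "\<And>e. e \<in> E \<Longrightarrow> 0 \<le> w e"
    and "\<And>e. e \<in> E \<Longrightarrow> 0 < p e \<and> p e < 1"
    and "LP_QC_optimal A B E p w x"
    and "\<And>a. a \<in> A \<Longrightarrow> query_order_distribution E p x a (D a)"
  shows "utility E p w (arrival_times A) (approx_QC A E p w x D) \<ge> (1 - 1 / exp 1) * OPT E p w"
proof -
  have finE: "finite E" using assms(1,2,5) finite_subset by blast
  define c where "c b = (\<Sum>e\<in>delta_B E b. x e * w e)" for b
  \<comment> \<open>Extension by zero outside \<open>E\<close>, so that every \<open>b\<close> faces
    a stopping problem on all of \<open>A\<close>.\<close>
  define x' where "x' b a = (if (a, b) \<in> E then x (a, b) else 0)" for b a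
  define v' where "v' b a = (if (a, b) \<in> E then w (a, b) else 0)" for b a
  have feas: "LP_QC_feasible A B E p x" using assms(8) by (simp add: LP_QC_optimal_def)
  have x0: "0 \<le> x e" if "e \<in> E" for e using feas that by (simp add: LP_QC_feasible_def)
  have \<delta>: "(\<Sum>e\<in>delta_B E b. g e) = (\<Sum>a\<in>A. if (a, b) \<in> E then g (a, b) else 0)"
    for b and g :: "'a \<times> 'b \<Rightarrow> real"
  proof -
    have "delta_B E b = (\<lambda>a. (a, b)) ` {a \<in> A. (a, b) \<in> E}"
      using assms(5) by (auto simp: delta_B_def)
    then show ?thesis
      using assms(1) by (simp add: sum.reindex inj_on_def sum.inter_filter)
  qed
  \<comment> \<open>The constraint at \<open>b\<close> for its full set of incident edges bounds the
    total candidate probability by a probability.\<close>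
  have x'1: "sum (x' b) A \<le> 1" if "b \<in> B" for b
  proof -
    have "sum (x' b) A \<le> prob_some_exists p (delta_B E b)"
      using feas that by (auto simp: LP_QC_feasible_def x'_def simp flip: \<delta>)
    also have "\<dots> \<le> 1"
      using assms(7) by (auto simp: prob_some_exists_def delta_B_def less_imp_le intro!: prod_nonneg)
    finally show ?thesis .
  qed
  have c_eq: "c b = (\<Sum>a\<in>A. x' b a * v' b a)" for b
    unfolding c_def \<delta> by (intro sum.cong) (auto simp: x'_def v'_def)
  obtain S where S: "\<And>a a' :: 'a. S a a' \<Longrightarrow> \<not> S a' a"
    and ord: "\<And>t. distinct (arrival_order A t)" "\<And>t. set (arrival_order A t) = A"
    and sorted: "\<And>t. sorted_wrt (arrives_before S t) (arrival_order A t)"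
    using arrival_order_sorted[OF assms(1)] by blast
  define h where "h b a s = (if (1 - exp (s - 1)) * c b \<le> v' b a then x' b a else 0)" for b a s
  define gain where "gain b t = (\<Sum>a\<in>A. h b a (t a) * v' b a *
    (\<Prod>a'\<in>{a'\<in>A. arrives_before S t a' a}. 1 - h b a' (t a')))" for b t
  have gain: "integrable (arrival_times A) (gain b)"
    "(1 - 1 / exp 1) * c b \<le> (\<integral>t. gain b t \<partial>arrival_times A)" if "b \<in> B" for b
    unfolding gain_def
    by (rule threshold_policy_expectation[where x = "x' b" and c = "c b"];
        use assms(1,6) x0 x'1[OF that] c_eq S in \<open>auto simp: h_def x'_def v'_def\<close>)+
  have h: "accept_prob E w c x b a s = h b a s" "h b a s * w (a, b) = h b a s * v' b a" for b a s
    by (auto simp: accept_prob_def h_def x'_def v'_def)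
  have asym: "arrives_before S t a a' \<Longrightarrow> \<not> arrives_before S t a' a" for t a a'
    using S by (auto simp: arrives_before_def)
  have "measure_pmf.expectation (output_law E p (approx_QC A E p w x D t)) (\<lambda>M. \<Sum>e\<in>M. w e) =
      (\<Sum>b\<in>B. gain b t)" for t
  proof -
    have "threshold_value (\<lambda>a. accept_prob E w c x b a (t a)) (\<lambda>a. w (a, b)) (arrival_order A t) =
        gain b t" for b
      using threshold_value_sorted[OF ord(1) sorted asym]
      by (simp add: ord h gain_def)
    then show ?thesis
      using expected_weight_approx_QC[OF finE assms(2,5,9) ord]
      unfolding c_def by simp
  qed
  then have "utility E p w (arrival_times A) (approx_QC A E p w x D) =
      (\<Sum>b\<in>B. \<integral>t. gain b t \<partial>arrival_times A)"
    unfolding utility_def using gain(1) by simp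
  also have "\<dots> \<ge> (\<Sum>b\<in>B. (1 - 1 / exp 1) * c b)"
    by (intro sum_mono gain(2))
  also have "(\<Sum>b\<in>B. (1 - 1 / exp 1) * c b) = (1 - 1 / exp 1) * (\<Sum>e\<in>E. x e * w e)"
  proof -
    \<comment> \<open>Every edge is counted once, at its endpoint in \<open>B\<close>.\<close>
    have "(\<Sum>b\<in>B. c b) = (\<Sum>e\<in>E. x e * w e)"
      unfolding c_def delta_B_def using assms(2,5) finE by (intro sum.group) auto
    then show ?thesis by (simp flip: sum_distrib_left)
  qed
  also have "(1 - 1 / exp 1) * (\<Sum>e\<in>E. x e * w e) \<ge> (1 - 1 / exp 1) * OPT E p w"
    using OPT_le_LP[OF finE _ assms(6,8)] assms(7)
    by (intro mult_left_mono) (auto simp: less_imp_le)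
  finally show ?thesis .
qed

end
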